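(* For every non-trivial weak tree $T$, $DD_{\mathrm{m}}(T) = S(T) = e_{\mathrm{m}}^\infty(T)$.
   Context: Graphs are finite, simple and undirected; a graph is non-trivial if it has at least two vertices. A weak graph is one in which no vertex is adjacent to two or more vertices of degree one. Swap number: a dominating set $D$ of a graph $G$ is a swap set if there is a dominating set $D'$ of $G$ with $D\cap D'=\emptyset$, $|D|=|D'|$, such that $G$ contains a perfect matching between $D$ and $D'$ (a bijection $f:D\to D'$ with $x f(x)\in E(G)$ for all $x\in D$). $DD_{\mathrm{m}}(G)$ is the minimum cardinality of a swap set of $G$, and $DD_{\mathrm{m}}(G)=\infty$ if none exists. Simple star partitioning: a star is $K_{1,n}$, $n\ge 1$; a single vertex $K_1$ is also allowed as a (degenerate) star part of order 1. A leaf is a vertex of degree one. A simple star partitioning $P$ of a non-trivial tree $T$ is a partition of $V(T)$ such that (i) each part induces a star (possibly $K_1$); (ii) each vertex of $T$ adjacent to exactly one leaf forms a $K_2$ part of $P$ together with this leaf; (iii) any $K_1$ part is adjacent to at least two parts that are not $K_1$'s (two parts are adjacent if some edge of $T$ joins them). A part of order $k$ has weight $k-1$; the weight of $P$ is the sum of the weights of its parts. $S(T)$ is the minimum weight of a simple star partitioning of $T$. Eviction number (m-eternal eviction model): guards occupy the vertices of a dominating set $D$ (one guard per vertex). When a vertex $v\in D$ is attacked, each guard moves to a vertex in the closed neighborhood of its current vertex so that the guards then occupy a dominating set $D'$ (of the same size) with $v\notin D'$. $e_{\mathrm{m}}^\infty(G)$ is the minimum number of guards that can defend against every infinite sequence of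 attacks; i.e. the least $k$ for which there is a non-empty family $\mathcal{F}$ of dominating sets of size $k$ such that for all $D\in\mathcal{F}$ and $v\in D$ there are $D'\in\mathcal{F}$ with $v\notin D'$ and a bijection $f:D\to D'$ with $f(x)\in N[x]$ for all $x\in D$. *)

theory Defs
  imports
    "Graph_Theory.Kuratowski"
    "HOL-Library.Disjoint_Sets"
    "HOL-Library.Extended_Nat"
begin

text \<open>
  Finite simple undirected graphs are the locale \<^locale>\<open>graph\<close>: finite, loop-free, symmetric
  digraphs without parallel arcs. Each edge is a pair of opposite arcs, and hence a
  \<^const>\<open>pre_digraph.cycle\<close> of length 2; the library's \<^const>\<open>tree\<close> therefore fails for every
  symmetric graph that has an edge. An undirected cycle is one of length at least 3.
\<close>

definition undirected_tree :: "('a, 'b) pre_digraph \<Rightarrow> bool" where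
  "undirected_tree G \<longleftrightarrow>
     connected G \<and> \<not> (\<exists>p. pre_digraph.cycle G p \<and> 3 \<le> length p)"

definition leaf :: "('a, 'b) pre_digraph \<Rightarrow> 'a \<Rightarrow> bool" where
  "leaf G v \<longleftrightarrow> v \<in> verts G \<and> out_degree G v = 1"

definition leaf_neighbours :: "('a, 'b) pre_digraph \<Rightarrow> 'a \<Rightarrow> 'a set" where
  "leaf_neighbours G v = {u. leaf G u \<and> v \<rightarrow>\<^bsub>G\<^esub> u}"

definition weak_graph :: "('a, 'b) pre_digraph \<Rightarrow> bool" where
  "weak_graph G \<longleftrightarrow> \<not> (\<exists>v \<in> verts G. 2 \<le> card (leaf_neighbours G v))"

definition dominating_set :: "('a, 'b) pre_digraph \<Rightarrow> 'a set \<Rightarrow> bool" where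
  "dominating_set G D \<longleftrightarrow> D \<subseteq> verts G \<and> (\<forall>v \<in> verts G - D. \<exists>u \<in> D. u \<rightarrow>\<^bsub>G\<^esub> v)"

definition swap_set :: "('a, 'b) pre_digraph \<Rightarrow> 'a set \<Rightarrow> bool" where
  "swap_set G D \<longleftrightarrow> dominating_set G D \<and>
     (\<exists>D'. dominating_set G D' \<and> D \<inter> D' = {} \<and> card D = card D' \<and>
        (\<exists>f. bij_betw f D D' \<and> (\<forall>x \<in> D. x \<rightarrow>\<^bsub>G\<^esub> f x)))"

text \<open>
  All three parameters are infima in \<^typ>\<open>enat\<close>: the minimum if the set is nonempty, \<open>\<infinity>\<close> otherwise.
\<close>

definition swap_number :: "('a, 'b) pre_digraph \<Rightarrow> enat" where
  "swap_number G = Inf {enat (card D) | D. swap_set G D}"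

definition star_part :: "('a, 'b) pre_digraph \<Rightarrow> 'a set \<Rightarrow> bool" where
  "star_part G A \<longleftrightarrow> K\<^bsub>1\<^esub> (G \<restriction> A) \<or> (\<exists>n \<ge> 1. K\<^bsub>1,n\<^esub> (G \<restriction> A))"

definition parts_adjacent :: "('a, 'b) pre_digraph \<Rightarrow> 'a set \<Rightarrow> 'a set \<Rightarrow> bool" where
  "parts_adjacent G A B \<longleftrightarrow> A \<noteq> B \<and> (\<exists>a \<in> A. \<exists>b \<in> B. a \<rightarrow>\<^bsub>G\<^esub> b)"

definition simple_star_partitioning :: "('a, 'b) pre_digraph \<Rightarrow> 'a set set \<Rightarrow> bool" where
  "simple_star_partitioning G P \<longleftrightarrow> partition_on (verts G) P \<and>
     (\<forall>A \<in> P. star_part G A) \<and>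
     (\<forall>v \<in> verts G. \<forall>l. leaf_neighbours G v = {l} \<longrightarrow> {v, l} \<in> P) \<and>
     (\<forall>A \<in> P. card A = 1 \<longrightarrow> 2 \<le> card {B \<in> P. card B \<noteq> 1 \<and> parts_adjacent G A B})"

definition partition_weight :: "'a set set \<Rightarrow> nat" where
  "partition_weight P = (\<Sum>A \<in> P. card A - 1)"

definition min_star_weight :: "('a, 'b) pre_digraph \<Rightarrow> enat" where
  "min_star_weight G = Inf {enat (partition_weight P) | P. simple_star_partitioning G P}"

definition closed_neighbourhood :: "('a, 'b) pre_digraph \<Rightarrow> 'a \<Rightarrow> 'a set" where
  "closed_neighbourhood G x = insert x {y. x \<rightarrow>\<^bsub>G\<^esub> y}"

definition eviction_family :: "('a, 'b) pre_digraph \<Rightarrow> nat \<Rightarrow> 'a set set \<Rightarrow> bool" where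
  "eviction_family G k F \<longleftrightarrow> F \<noteq> {} \<and>
     (\<forall>D \<in> F. dominating_set G D \<and> card D = k) \<and>
     (\<forall>D \<in> F. \<forall>v \<in> D. \<exists>D' \<in> F. v \<notin> D' \<and>
        (\<exists>f. bij_betw f D D' \<and> (\<forall>x \<in> D. f x \<in> closed_neighbourhood G x)))"

definition eviction_number :: "('a, 'b) pre_digraph \<Rightarrow> enat" where
  "eviction_number G = Inf {enat k | k. \<exists>F. eviction_family G k F}"

end

theory Submission
  imports Defs
begin

text \<open>
  Root the tree at a neighbour \<open>r\<close> of a leaf. A bottom-up recursion assigns to every vertex \<open>v\<close> a
  kind and a number \<open>min_edges v\<close>; all three parameters turn out to equal \<open>min_edges r\<close>.

  A swap set amounts to a matching such that every unmatched vertex has at least two matched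
  neighbours: the tree structure allows the matched vertices to be coloured so that the two ends of
  every edge of the matching get different colours and every unmatched vertex sees both colours.
  The edges of the matching and the unmatched vertices form a simple star partitioning, and the two
  colour classes alternate as an eviction family, so it remains to find such a matching with
  \<open>min_edges r\<close> edges and to show that this number bounds the other two parameters from below.

  Here \<open>min_edges v\<close> is the least number of edges that a solution can spend strictly below \<open>v\<close>.
  At that cost, a supporting \<open>v\<close> can be matched to a child, a neutral \<open>v\<close> can stay
  unmatched, a needy \<open>v\<close> can stay unmatched provided that its parent is matched, and a demanding
  \<open>v\<close> has to be matched to its parent. Guards and stars obey the same rules: whoever spends only
  \<open>min_edges v\<close> on the subtree at \<open>v\<close> makes the corresponding demand on the parent of \<open>v\<close>. In
  particular, a subtree at a demanding \<open>v\<close> with only \<open>min_edges v\<close> guards forces a guard on the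
  parent of \<open>v\<close>, even when \<open>v\<close> is dominated from below at the moment.
\<close>

unbundle no funcset_syntax

section \<open>Guards, swap sets and matchings\<close>

lemma dominating_setD:
  assumes "dominating_set G D"
  shows "D \<subseteq> verts G" "v \<in> verts G \<Longrightarrow> v \<notin> D \<Longrightarrow> \<exists>u\<in>D. u \<rightarrow>\<^bsub>G\<^esub> v"
  using assms by (auto simp: dominating_set_def)

lemma swap_setI:
  assumes "inj_on a I" "inj_on b I" "a ` I \<inter> b ` I = {}"
    and "dominating_set G (a ` I)" "dominating_set G (b ` I)"
    and adj: "\<And>i. i \<in> I \<Longrightarrow> a i \<rightarrow>\<^bsub>G\<^esub> b i"
  shows "swap_set G (a ` I)"
  unfolding swap_set_def
proof (intro conjI exI ballI)
  let ?f = "b \<circ> inv_into I a"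
  show "bij_betw ?f (a ` I) (b ` I)"
    using assms(1,2) by (intro bij_betw_trans[of _ _ I] bij_betw_inv_into inj_on_imp_bij_betw)
  then show "card (a ` I) = card (b ` I)" by (rule bij_betw_same_card)
  show "x \<rightarrow>\<^bsub>G\<^esub> ?f x" if "x \<in> a ` I" for x
    using that adj assms(1) by auto
qed fact+

definition guards_move :: "('a, 'b) pre_digraph \<Rightarrow> 'a set \<Rightarrow> 'a set \<Rightarrow> bool" where
  "guards_move G D D' \<longleftrightarrow>
     (\<exists>f. bij_betw f D D' \<and> (\<forall>x\<in>D. f x \<in> closed_neighbourhood G x))"

lemma eviction_family_iff:
  "eviction_family G k F \<longleftrightarrow> F \<noteq> {} \<and> (\<forall>D\<in>F. dominating_set G D \<and> card D = k) \<and>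
     (\<forall>D\<in>F. \<forall>v\<in>D. \<exists>D'\<in>F. v \<notin> D' \<and> guards_move G D D')"
  by (simp add: eviction_family_def guards_move_def)

context graph
begin

lemma guards_move_sym:
  assumes "guards_move G D D'"
  shows "guards_move G D' D"
proof -
  obtain f where f: "bij_betw f D D'" "\<forall>x\<in>D. f x \<in> closed_neighbourhood G x"
    using assms by (auto simp: guards_move_def)
  have "inv_into D f y \<in> closed_neighbourhood G y" if "y \<in> D'" for y
  proof -
    have "inv_into D f y \<in> D" "f (inv_into D f y) = y"
      using f(1) that by (auto simp: bij_betw_def inv_into_into f_inv_into_f)
    then have "y \<in> closed_neighbourhood G (inv_into D f y)" using f(2) by metis
    then show ?thesis by (auto simp: closed_neighbourhood_def intro: graph_symmetric)
  qed
  then show ?thesis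
    unfolding guards_move_def using bij_betw_inv_into[OF f(1)] by blast
qed

lemma eviction_number_le_swap_number: "eviction_number G \<le> swap_number G"
proof -
  have "\<exists>F. eviction_family G (card D) F" if swap: "swap_set G D" for D
  proof -
    obtain D' f where D': "dominating_set G D" "dominating_set G D'" "D \<inter> D' = {}"
        "card D = card D'"
      and f: "bij_betw f D D'" "\<forall>x\<in>D. x \<rightarrow> f x"
      using swap unfolding swap_set_def by blast
    have "guards_move G D D'" using f by (auto simp: guards_move_def closed_neighbourhood_def)
    then have "eviction_family G (card D) {D, D'}"
      using D' guards_move_sym by (auto simp: eviction_family_iff)
    then show ?thesis by blast
  qed
  then show ?thesis
    unfolding eviction_number_def swap_number_def by (intro Inf_superset_mono) blast
qed

lemma out_degree_eq_card: "out_degree G v = card {w. v \<rightarrow> w}"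
proof -
  have "bij_betw (head G) (out_arcs G v) {w. v \<rightarrow> w}"
    by (auto simp: bij_betw_def inj_on_def arcs_ends_conv arc_to_ends_def intro: no_multi_arcs)
  then show ?thesis by (simp add: out_degree_def bij_betw_same_card)
qed

lemma leaf_neighbour_unique: "leaf G l \<Longrightarrow> l \<rightarrow> u \<Longrightarrow> l \<rightarrow> w \<Longrightarrow> u = w"
  by (metis card_1_singletonE leaf_def mem_Collect_eq out_degree_eq_card singletonD)

lemma arcs_ends_induce: "arcs_ends (G \<restriction> A) = arcs_ends G \<inter> A \<times> A"
  by (auto simp: arcs_ends_conv)

lemma graph_induce: "A \<subseteq> verts G \<Longrightarrow> graph (G \<restriction> A)"
  by (intro digraph.graphI digraphI_induced induced_graph_imp_symmetric[OF sym_arcs] induced_induce)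

lemma star_part_singleton:
  assumes "v \<in> verts G"
  shows "star_part G {v}"
proof -
  have "K\<^bsub>1\<^esub> (G \<restriction> {v})"
    unfolding complete_digraph_def
    using assms graph_induce[of "{v}"] adj_not_same by (auto simp: arcs_ends_induce)
  then show ?thesis by (simp add: star_part_def)
qed

lemma star_part_edge:
  assumes "x \<rightarrow> y"
  shows "star_part G {x, y}"
proof -
  have "x \<noteq> y" using assms adj_not_same by blast
  have "graph (G \<restriction> {x, y})" using assms by (intro graph_induce) (auto dest: adj_in_verts)
  moreover have "arcs_ends (G \<restriction> {x, y}) = {x} \<times> {y} \<union> {y} \<times> {x}"
    using assms graph_symmetric adj_not_same by (auto simp: arcs_ends_induce)
  moreover have "verts (G \<restriction> {x, y}) = {x} \<union> {y}" "{x} \<inter> {y} = {}" using \<open>x \<noteq> y\<close> by auto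
  moreover have "card {x} = 1" "card {y} = 1" by simp_all
  ultimately have "K\<^bsub>1,1\<^esub> (G \<restriction> {x, y})"
    unfolding complete_bipartite_digraph_def by blast
  then show ?thesis by (auto simp: star_part_def)
qed

lemma star_part_neighbour:
  assumes "star_part G A" "card A \<noteq> 1" "x \<in> A"
  obtains y where "y \<in> A" "x \<rightarrow> y"
proof -
  have "\<not> K\<^bsub>1\<^esub> (G \<restriction> A)" using assms(2) by (simp add: complete_digraph_def)
  then obtain n X Y where bipartition: "1 \<le> n" "A = X \<union> Y" "card X = 1" "card Y = n"
      "arcs_ends (G \<restriction> A) = X \<times> Y \<union> Y \<times> X"
    using assms(1) by (auto simp: star_part_def complete_bipartite_digraph_def)
  then have "X \<noteq> {}" "Y \<noteq> {}" by auto
  then obtain y where "(x, y) \<in> arcs_ends (G \<restriction> A)" "y \<in> A" using bipartition assms(3) by fastforce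
  then show ?thesis using that by (auto simp: arcs_ends_induce)
qed

definition triangle_free :: bool where
  "triangle_free \<longleftrightarrow> (\<forall>x y z. x \<rightarrow> y \<longrightarrow> y \<rightarrow> z \<longrightarrow> \<not> x \<rightarrow> z)"

definition doubly_dominating_matching :: "'a set set \<Rightarrow> bool" where
  "doubly_dominating_matching M \<longleftrightarrow> (\<forall>A\<in>M. \<exists>x y. x \<rightarrow> y \<and> A = {x, y}) \<and> disjoint M \<and>
     (\<forall>v \<in> verts G - \<Union>M. \<exists>x\<in>\<Union>M. \<exists>y\<in>\<Union>M. x \<noteq> y \<and> v \<rightarrow> x \<and> v \<rightarrow> y)"

definition matching_partition :: "'a set set \<Rightarrow> 'a set set" where
  "matching_partition M = M \<union> (\<lambda>v. {v}) ` (verts G - \<Union>M)"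

context
  fixes M :: "'a set set"
  assumes matching: "doubly_dominating_matching M"
begin

lemma matching_edge: "A \<in> M \<Longrightarrow> \<exists>x y. x \<rightarrow> y \<and> A = {x, y}"
  using matching by (simp add: doubly_dominating_matching_def)

lemma card_matching_edge: "A \<in> M \<Longrightarrow> card A = 2"
  using matching_edge adj_not_same by (metis card_2_iff)

lemma matching_edges_disjoint: "A \<in> M \<Longrightarrow> B \<in> M \<Longrightarrow> A \<noteq> B \<Longrightarrow> A \<inter> B = {}"
  using matching by (simp add: doubly_dominating_matching_def disjoint_def)

lemma unmatched_two_neighbours:
  "v \<in> verts G \<Longrightarrow> v \<notin> \<Union>M \<Longrightarrow> \<exists>x\<in>\<Union>M. \<exists>y\<in>\<Union>M. x \<noteq> y \<and> v \<rightarrow> x \<and> v \<rightarrow> y"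
  using matching by (simp add: doubly_dominating_matching_def)

lemma matched_subset_verts: "\<Union>M \<subseteq> verts G"
  by (auto dest!: matching_edge dest: adj_in_verts)

lemma finite_matching: "finite M"
  using matched_subset_verts finite_UnionD finite_subset finite_verts by blast

lemma partition_on_matching_partition: "partition_on (verts G) (matching_partition M)"
proof (rule partition_onI)
  show "\<Union>(matching_partition M) = verts G"
    using matched_subset_verts by (auto simp: matching_partition_def)
  show "disjnt A B" if "A \<in> matching_partition M" "B \<in> matching_partition M" "A \<noteq> B" for A B
    using that matching_edges_disjoint by (auto simp: matching_partition_def disjnt_def)
  show "{} \<notin> matching_partition M"
    using card_matching_edge by (force simp: matching_partition_def)
qed

lemma partition_weight_matching_partition: "partition_weight (matching_partition M) = card M"
proof -
  let ?K1 = "(\<lambda>v. {v}) ` (verts G - \<Union>M)"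
  have "M \<inter> ?K1 = {}" by auto
  then have "partition_weight (matching_partition M) = (\<Sum>A\<in>M. card A - 1) + (\<Sum>A\<in>?K1. card A - 1)"
    unfolding partition_weight_def matching_partition_def using finite_matching
    by (intro sum.union_disjoint) auto
  also have "(\<Sum>A\<in>?K1. card A - 1) = 0" by (intro sum.neutral) auto
  also have "(\<Sum>A\<in>M. card A - 1) = card M" using card_matching_edge by simp
  finally show ?thesis by simp
qed

lemma matching_partition_leaf_edge:
  assumes "leaf G l" "v \<rightarrow> l"
  shows "{v, l} \<in> matching_partition M"
proof -
  have v_only: "w = v" if "l \<rightarrow> w" for w
    using leaf_neighbour_unique[OF assms(1) that] graph_symmetric[OF assms(2)] by simp
  have "l \<in> \<Union>M"
    using unmatched_two_neighbours[OF adj_in_verts(2)[OF assms(2)]] v_only by blast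
  then obtain x y where "x \<rightarrow> y" "{x, y} \<in> M" "l \<in> {x, y}" using matching_edge by blast
  moreover from this have "{v, l} = {x, y}" using v_only graph_symmetric by blast
  ultimately show ?thesis by (simp add: matching_partition_def)
qed

lemma matching_partition_adjacent_parts:
  assumes triangle_free "A \<in> matching_partition M" "card A = 1"
  shows "2 \<le> card {B \<in> matching_partition M. card B \<noteq> 1 \<and> parts_adjacent G A B}"
    (is "2 \<le> card ?S")
proof -
  obtain v where v: "v \<in> verts G" "v \<notin> \<Union>M" "A = {v}"
    using assms(2,3) card_matching_edge by (force simp: matching_partition_def)
  obtain B C x y where xy: "B \<in> M" "C \<in> M" "x \<in> B" "y \<in> C" "x \<noteq> y" "v \<rightarrow> x" "v \<rightarrow> y"
    using unmatched_two_neighbours[OF v(1,2)] by blast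
  have "B \<noteq> C"
  proof
    assume "B = C"
    then have "x \<rightarrow> y" using matching_edge[OF xy(1)] xy graph_symmetric by auto
    then show False using assms(1) xy(6,7) by (auto simp: triangle_free_def)
  qed
  then have "card {B, C} = 2" by simp
  moreover have "{B, C} \<subseteq> ?S"
    using xy v card_matching_edge by (auto simp: matching_partition_def parts_adjacent_def)
  moreover have "finite ?S" using finite_matching by (simp add: matching_partition_def)
  ultimately show ?thesis using card_mono[of ?S "{B, C}"] by simp
qed

lemma simple_star_partitioning_matching_partition:
  assumes triangle_free
  shows "simple_star_partitioning G (matching_partition M)"
  unfolding simple_star_partitioning_def
proof (intro conjI ballI allI impI)
  show "star_part G A" if "A \<in> matching_partition M" for A
    using that matching_edge star_part_edge star_part_singleton
    by (auto simp: matching_partition_def)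
  show "{v, l} \<in> matching_partition M" if "leaf_neighbours G v = {l}" for v l
    using that by (intro matching_partition_leaf_edge) (auto simp: leaf_neighbours_def)
qed (use assms partition_on_matching_partition matching_partition_adjacent_parts in blast)+

end

lemma matching_of_swap_set:
  assumes "swap_set G D"
  obtains M where "doubly_dominating_matching M" "card M = card D"
proof -
  obtain D' f where D: "dominating_set G D" and D': "dominating_set G D'" and disj: "D \<inter> D' = {}"
    and f: "bij_betw f D D'" "\<And>x. x \<in> D \<Longrightarrow> x \<rightarrow> f x"
    using assms by (auto simp: swap_set_def)
  define M where "M = (\<lambda>x. {x, f x}) ` D"
  have f_in: "f x \<in> D'" "f x \<notin> D" if "x \<in> D" for x
    using that f(1) disj by (auto simp: bij_betw_def)
  have inj: "inj_on f D" and UnM: "\<Union>M = D \<union> D'" using f(1) by (auto simp: bij_betw_def M_def)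
  have "disjoint M"
    using f_in inj by (auto simp: M_def disjoint_def dest: inj_onD)
  moreover have "\<exists>x\<in>\<Union>M. \<exists>y\<in>\<Union>M. x \<noteq> y \<and> v \<rightarrow> x \<and> v \<rightarrow> y" if "v \<in> verts G - \<Union>M" for v
  proof -
    have "v \<in> verts G" "v \<notin> D" "v \<notin> D'" using that UnM by auto
    then obtain x y where "x \<in> D" "x \<rightarrow> v" "y \<in> D'" "y \<rightarrow> v"
      using dominating_setD(2)[OF D] dominating_setD(2)[OF D'] by blast
    then show ?thesis using disj UnM graph_symmetric by (intro bexI[of _ x] bexI[of _ y]) auto
  qed
  ultimately have "doubly_dominating_matching M"
    using f(2) by (auto simp: doubly_dominating_matching_def M_def)
  moreover have "card M = card D"
    unfolding M_def using f_in by (intro card_image inj_onI) (auto simp: doubleton_eq_iff)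
  ultimately show ?thesis using that by blast
qed

lemma min_star_weight_le_swap_number:
  assumes triangle_free
  shows "min_star_weight G \<le> swap_number G"
proof -
  have "\<exists>P. simple_star_partitioning G P \<and> partition_weight P = card D" if "swap_set G D" for D
    using matching_of_swap_set[OF that] simple_star_partitioning_matching_partition[OF _ assms]
      partition_weight_matching_partition by metis
  then show ?thesis
    unfolding min_star_weight_def swap_number_def by (intro Inf_superset_mono) (clarsimp, metis)
qed

end

section \<open>Rooted trees\<close>

locale rooted_tree = graph G for G :: "('a, 'b) pre_digraph" (structure) +
  fixes r :: 'a and par :: "'a \<Rightarrow> 'a" and depth :: "'a \<Rightarrow> nat"
  assumes root_in_verts: "r \<in> verts G"
    and adj_par: "v \<in> verts G \<Longrightarrow> v \<noteq> r \<Longrightarrow> v \<rightarrow> par v"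
    and depth_par: "v \<in> verts G \<Longrightarrow> v \<noteq> r \<Longrightarrow> depth (par v) < depth v"
    and adj_cases: "x \<rightarrow> y \<Longrightarrow> x \<noteq> r \<and> par x = y \<or> y \<noteq> r \<and> par y = x"
begin

lemma par_in_verts: "v \<in> verts G \<Longrightarrow> v \<noteq> r \<Longrightarrow> par v \<in> verts G"
  using adj_par adj_in_verts(2) by blast

definition children :: "'a \<Rightarrow> 'a set" where
  "children v = {w \<in> verts G - {r}. par w = v}"

lemma child_in_verts: "w \<in> children v \<Longrightarrow> w \<in> verts G"
  and child_not_root: "w \<in> children v \<Longrightarrow> w \<noteq> r"
  and par_child: "w \<in> children v \<Longrightarrow> par w = v"
  and parent_in_verts: "w \<in> children v \<Longrightarrow> v \<in> verts G"
  and depth_child: "w \<in> children v \<Longrightarrow> depth v < depth w"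
  and adj_child: "w \<in> children v \<Longrightarrow> v \<rightarrow> w"
  and child_adj: "w \<in> children v \<Longrightarrow> w \<rightarrow> v"
  using par_in_verts depth_par adj_par graph_symmetric by (auto simp: children_def)

lemma in_children_par: "v \<in> verts G \<Longrightarrow> v \<noteq> r \<Longrightarrow> v \<in> children (par v)"
  by (simp add: children_def)

lemma finite_children [simp]: "finite (children v)"
  by (simp add: children_def)

lemma adj_iff_children: "x \<rightarrow> y \<longleftrightarrow> x \<in> children y \<or> y \<in> children x"
  using adj_cases adj_in_verts adj_child child_adj in_children_par by metis

lemma par_eq_shallower_neighbour: "x \<rightarrow> y \<Longrightarrow> depth y \<le> depth x \<Longrightarrow> par x = y"
  using adj_iff_children par_child depth_child not_le by metis

lemma triangle_free_rooted_tree: triangle_free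
proof -
  have False if "x \<rightarrow> y" "y \<rightarrow> z" "x \<rightarrow> z" for x y z
  proof -
    have adj: "y \<rightarrow> x" "z \<rightarrow> y" "z \<rightarrow> x" using that graph_symmetric by auto
    consider "depth y \<le> depth x" "depth z \<le> depth x" | "depth x \<le> depth y" "depth z \<le> depth y"
      | "depth x \<le> depth z" "depth y \<le> depth z"
      by linarith
    then have "y = z \<or> x = z \<or> x = y"
      using that adj par_eq_shallower_neighbour by cases metis+
    then show False using that adj_not_same by blast
  qed
  then show ?thesis by (auto simp: triangle_free_def)
qed

definition height :: "'a \<Rightarrow> nat" where
  "height v = Max (depth ` verts G) - depth v"

lemma height_child:
  assumes "w \<in> children v"
  shows "height w < height v"
proof -
  have "depth v < depth w" "depth w \<le> Max (depth ` verts G)"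
    using child_in_verts[OF assms] depth_child[OF assms] by auto
  then show ?thesis unfolding height_def by linarith
qed

lemma children_induct [consumes 1, case_names children]:
  assumes "v \<in> verts G" and "\<And>v. v \<in> verts G \<Longrightarrow> (\<And>w. w \<in> children v \<Longrightarrow> P w) \<Longrightarrow> P v"
  shows "P v"
  using assms(1)
  by (induction v rule: measure_induct_rule[of height])
    (use assms(2) in \<open>blast dest: height_child child_in_verts\<close>)

lemma ex_childless_vertex:
  assumes "v \<in> verts G" "v \<noteq> r"
  obtains l where "l \<in> verts G" "l \<noteq> r" "children l = {}"
  using assms by (induction v rule: children_induct) (use child_not_root in blast)

lemma leaf_iff_childless:
  assumes "v \<in> verts G" "v \<noteq> r"
  shows "leaf G v \<longleftrightarrow> children v = {}"
proof -
  have "{w. v \<rightarrow> w} = insert (par v) (children v)"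
    using assms in_children_par par_child by (auto simp: adj_iff_children)
  moreover have "par v \<notin> children v"
    using depth_par[OF assms] depth_child by fastforce
  ultimately show ?thesis using assms(1) by (simp add: leaf_def out_degree_eq_card)
qed

inductive_set subtree :: "'a \<Rightarrow> 'a set" for v where
  self: "v \<in> subtree v"
| child: "x \<in> subtree v \<Longrightarrow> w \<in> children x \<Longrightarrow> w \<in> subtree v"

lemma subtree_depth: "x \<in> subtree v \<Longrightarrow> depth v \<le> depth x"
  by (induction rule: subtree.induct) (auto dest: depth_child)

lemma subtree_par: "x \<in> subtree v \<Longrightarrow> x = v \<or> x \<in> verts G \<and> x \<noteq> r \<and> par x \<in> subtree v"
  by (induction rule: subtree.induct) (auto dest: child_in_verts child_not_root par_child)

lemma finite_subtree [simp]: "finite (subtree v)"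
proof (rule finite_subset)
  show "subtree v \<subseteq> insert v (verts G)" using subtree_par by blast
qed simp

lemma subtree_child_subset:
  assumes "w \<in> children v"
  shows "subtree w \<subseteq> subtree v"
proof
  show "x \<in> subtree v" if "x \<in> subtree w" for x
    using that by induction (use assms in \<open>auto intro: subtree.intros\<close>)
qed

lemma subtree_unfold: "subtree v = insert v (\<Union>w\<in>children v. subtree w)"
proof
  show "subtree v \<subseteq> insert v (\<Union>w\<in>children v. subtree w)"
  proof
    show "x \<in> insert v (\<Union>w\<in>children v. subtree w)" if "x \<in> subtree v" for x
      using that by induction (auto intro: subtree.intros)
  qed
qed (use subtree_child_subset in \<open>auto intro: subtree.intros\<close>)

lemma notin_subtree_child: "w \<in> children v \<Longrightarrow> v \<notin> subtree w"
  using subtree_depth depth_child by fastforce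

lemma subtree_disjoint:
  assumes "w \<in> children v" "w' \<in> children v" "w \<noteq> w'"
  shows "subtree w \<inter> subtree w' = {}"
proof -
  have "x \<notin> subtree w'" if "x \<in> subtree w" for x
    using that
  proof induction
    case self
    then show ?case using assms subtree_par notin_subtree_child par_child by metis
  next
    case (child x y)
    then show ?case using assms subtree_par notin_subtree_child par_child by metis
  qed
  then show ?thesis by auto
qed

lemma subtree_root: "subtree r = verts G"
proof
  show "subtree r \<subseteq> verts G" using subtree_par root_in_verts by blast
  have "x \<in> verts G \<Longrightarrow> x \<in> subtree r" for x
    by (induction x rule: measure_induct_rule[of depth])
      (metis depth_par in_children_par par_in_verts subtree.child subtree.self)
  then show "verts G \<subseteq> subtree r" by blast
qed

lemma card_Int_subtree:
  "card (U \<inter> subtree v) = of_bool (v \<in> U) + (\<Sum>w\<in>children v. card (U \<inter> subtree w))"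
proof -
  have "card (\<Union>w\<in>children v. U \<inter> subtree w) = (\<Sum>w\<in>children v. card (U \<inter> subtree w))"
    using subtree_disjoint by (intro card_UN_disjoint) auto
  moreover have "U \<inter> subtree v = (U \<inter> {v}) \<union> (\<Union>w\<in>children v. U \<inter> subtree w)"
    by (subst subtree_unfold) auto
  moreover have "card ((U \<inter> {v}) \<union> (\<Union>w\<in>children v. U \<inter> subtree w))
      = card (U \<inter> {v}) + card (\<Union>w\<in>children v. U \<inter> subtree w)"
    using notin_subtree_child by (intro card_Un_disjoint) auto
  ultimately show ?thesis by auto
qed

end

section \<open>Kinds of vertices\<close>

datatype kind = Supporting | Neutral | Needy | Demanding

context rooted_tree
begin

function kind :: "'a \<Rightarrow> kind" where
  "kind v =
    (if \<exists>w\<in>children v. kind w = Demanding then Supporting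
     else if \<exists>w\<in>children v. kind w = Needy then Demanding
     else if \<forall>w\<in>children v. kind w \<noteq> Supporting then Demanding
     else if \<exists>h\<in>children v. \<forall>w\<in>children v. kind w = Supporting \<longrightarrow> w = h then Needy
     else Neutral)"
  by auto
termination by (relation "measure height") (auto simp: height_child)

declare kind.simps [simp del]

function min_edges :: "'a \<Rightarrow> nat" where
  "min_edges v = (\<Sum>w\<in>children v. min_edges w + of_bool (kind w = Demanding))"
  by auto
termination by (relation "measure height") (auto simp: height_child)

declare min_edges.simps [simp del]

lemma kind_Supporting_iff: "kind v = Supporting \<longleftrightarrow> (\<exists>w\<in>children v. kind w = Demanding)"
  by (simp add: kind.simps[of v])

lemma kind_childless: "children v = {} \<Longrightarrow> kind v = Demanding"
  by (simp add: kind.simps[of v])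

lemma kind_parent_of_Needy:
  "w \<in> children v \<Longrightarrow> kind w = Needy \<Longrightarrow> kind v = Supporting \<or> kind v = Demanding"
  by (auto simp: kind.simps[of v])

lemma kind_DemandingD:
  assumes "kind v = Demanding"
  shows "(\<exists>w\<in>children v. kind w = Needy) \<or> (\<forall>w\<in>children v. kind w = Neutral)"
proof (rule disjCI)
  assume "\<not> (\<forall>w\<in>children v. kind w = Neutral)"
  then obtain w where w: "w \<in> children v" "kind w \<noteq> Neutral" by blast
  then show "\<exists>w\<in>children v. kind w = Needy"
    using assms kind.simps[of v] by (cases "kind w") (auto split: if_splits)
qed

lemma kind_NeedyD:
  assumes "kind v = Needy"
  obtains h where "h \<in> children v" "kind h = Supporting"
    "\<And>w. w \<in> children v \<Longrightarrow> kind w = Supporting \<Longrightarrow> w = h"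
proof -
  have "\<exists>h\<in>children v. \<forall>w\<in>children v. kind w = Supporting \<longrightarrow> w = h"
    "\<exists>w\<in>children v. kind w = Supporting"
    using assms kind.simps[of v] by (auto split: if_splits)
  then show ?thesis using that by blast
qed

lemma kind_NeutralD:
  assumes "kind v = Neutral"
  obtains h h' where "h \<in> children v" "kind h = Supporting"
    "h' \<in> children v" "kind h' = Supporting" "h \<noteq> h'"
proof -
  have "\<exists>w\<in>children v. kind w = Supporting"
    "\<not> (\<exists>h\<in>children v. \<forall>w\<in>children v. kind w = Supporting \<longrightarrow> w = h)"
    using assms kind.simps[of v] by (auto split: if_splits)
  then show ?thesis using that by blast
qed

lemma min_edges_eq_sum:
  "kind v \<noteq> Supporting \<Longrightarrow> min_edges v = (\<Sum>w\<in>children v. min_edges w)"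
  using kind_Supporting_iff by (subst min_edges.simps) auto

lemma min_edges_eq_if_sum_le:
  assumes "kind v \<noteq> Supporting"
    and "\<And>w. w \<in> children v \<Longrightarrow> min_edges w \<le> g w"
    and "(\<Sum>w\<in>children v. g w) \<le> min_edges v" "w \<in> children v"
  shows "g w = min_edges w"
proof -
  have "(\<Sum>w\<in>children v. min_edges w) \<le> (\<Sum>w\<in>children v. g w)"
    using assms(2) by (rule sum_mono)
  then have "(\<Sum>w\<in>children v. min_edges w) = (\<Sum>w\<in>children v. g w)"
    using assms(3) min_edges_eq_sum[OF assms(1)] by linarith
  then show ?thesis
    using sum_mono_inv[of min_edges "children v" g w] assms(2,4) by simp
qed

end

section \<open>Lower bound for the eviction number\<close>

context rooted_tree
begin

lemma card_Int_subtree_guards_move_le: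
  assumes "guards_move G D D'" and "v = r \<or> par v \<notin> D \<or> v \<notin> D'"
  shows "card (D' \<inter> subtree v) \<le> card (D \<inter> subtree v)"
proof -
  obtain f where f: "f ` D = D'" "\<And>x. x \<in> D \<Longrightarrow> f x = x \<or> x \<rightarrow> f x"
    using assms(1) by (auto simp: guards_move_def bij_betw_def closed_neighbourhood_def)
  have "D' \<inter> subtree v \<subseteq> f ` (D \<inter> subtree v)"
  proof
    fix y assume y: "y \<in> D' \<inter> subtree v"
    then obtain x where x: "x \<in> D" "f x = y" using f(1) by blast
    have "x \<in> subtree v"
    proof (cases "x = y \<or> x \<in> children y")
      case True
      then show ?thesis using y by (auto intro: subtree.child)
    next
      case False
      then have "y \<in> children x" using f(2)[OF x(1)] x by (auto simp: adj_iff_children)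
      then have "par y = x" "y \<noteq> r" by (auto dest: par_child child_not_root)
      then show ?thesis using subtree_par[of y v] y x assms(2) by auto
    qed
    then show "y \<in> f ` (D \<inter> subtree v)" using x by auto
  qed
  then show ?thesis by (rule surj_card_le[rotated]) simp
qed

definition guard_tight :: "'a set \<Rightarrow> 'a \<Rightarrow> bool" where
  "guard_tight D v \<longleftrightarrow> card (D \<inter> subtree v) = min_edges v"

definition guard_demand_met :: "'a set \<Rightarrow> 'a \<Rightarrow> bool" where
  "guard_demand_met D v = (case kind v of
      Supporting \<Rightarrow> True
    | Neutral \<Rightarrow> v \<notin> D
    | Needy \<Rightarrow> v \<notin> D \<and> (v \<noteq> r \<and> par v \<in> D \<or> (\<exists>h\<in>children v. kind h = Supporting \<and> h \<in> D))
    | Demanding \<Rightarrow> v \<notin> D \<and> v \<noteq> r \<and> par v \<in> D)"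

definition guard_bound :: "'a set \<Rightarrow> 'a \<Rightarrow> bool" where
  "guard_bound D v \<longleftrightarrow>
     min_edges v \<le> card (D \<inter> subtree v) \<and> (guard_tight D v \<longrightarrow> guard_demand_met D v)"

lemma guard_tight_unoccupied:
  assumes "\<And>w. w \<in> children v \<Longrightarrow> guard_bound D w" and "kind v \<noteq> Supporting" "guard_tight D v"
  shows "v \<notin> D" and "w \<in> children v \<Longrightarrow> guard_tight D w \<and> guard_demand_met D w"
proof -
  have min_edges_le: "min_edges w \<le> card (D \<inter> subtree w)" if "w \<in> children v" for w
    using assms(1)[OF that] by (simp add: guard_bound_def)
  have min_edges_split: "min_edges v = of_bool (v \<in> D) + (\<Sum>w\<in>children v. card (D \<inter> subtree w))"
    using assms(3) card_Int_subtree[of D v] by (simp add: guard_tight_def)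
  then have card_eq: "card (D \<inter> subtree w) = min_edges w" if "w \<in> children v" for w
    using that min_edges_le assms(2) by (intro min_edges_eq_if_sum_le[of v]) auto
  then show "w \<in> children v \<Longrightarrow> guard_tight D w \<and> guard_demand_met D w"
    using assms(1) by (simp add: guard_bound_def guard_tight_def)
  have "(\<Sum>w\<in>children v. card (D \<inter> subtree w)) = min_edges v"
    using card_eq min_edges_eq_sum[OF assms(2)] by simp
  then show "v \<notin> D" using min_edges_split by (cases "v \<in> D") auto
qed

lemma guard_tight_dominator:
  assumes "dominating_set G D" "v \<in> verts G" "kind v \<noteq> Supporting" "guard_tight D v"
    and "\<And>w. w \<in> children v \<Longrightarrow> guard_bound D w"
  shows "v \<noteq> r \<and> par v \<in> D \<or> (\<exists>h\<in>children v. kind h = Supporting \<and> h \<in> D)"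
proof -
  have "v \<notin> D" using guard_tight_unoccupied(1) assms(3-5) by blast
  then obtain u where u: "u \<in> D" "u \<rightarrow> v" using dominating_setD(2)[OF assms(1,2)] by blast
  then consider (child) "u \<in> children v" | (parent) "v \<in> children u"
    by (auto simp: adj_iff_children)
  then show ?thesis
  proof cases
    case child
    then have "guard_demand_met D u" using guard_tight_unoccupied(2) assms(3-5) by blast
    then have "kind u = Supporting"
      using u(1) by (auto simp: guard_demand_met_def split: kind.splits)
    then show ?thesis using child u(1) by blast
  next
    case parent
    then show ?thesis using u(1) child_not_root par_child by blast
  qed
qed

lemma guard_bound_unoccupied:
  assumes "\<And>w. w \<in> children v \<Longrightarrow> guard_bound D w" "v \<notin> D"
  shows "min_edges v \<le> card (D \<inter> subtree v)"
proof -
  have "min_edges w + of_bool (kind w = Demanding) \<le> card (D \<inter> subtree w)" if "w \<in> children v" for w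
    using assms(1)[OF that] assms(2) par_child[OF that]
    by (cases "guard_tight D w") (auto simp: guard_bound_def guard_demand_met_def guard_tight_def)
  then have "min_edges v \<le> (\<Sum>w\<in>children v. card (D \<inter> subtree w))"
    by (subst min_edges.simps) (intro sum_mono)
  then show ?thesis by (simp add: card_Int_subtree[of D v])
qed

context
  fixes F :: "'a set set" and k :: nat
  assumes family: "eviction_family G k F"
begin

lemma family_dominating: "D \<in> F \<Longrightarrow> dominating_set G D"
  using family by (simp add: eviction_family_iff)

lemma family_evict:
  assumes "D \<in> F" "v \<in> D"
  obtains D' where "D' \<in> F" "v \<notin> D'" "guards_move G D D'"
  using assms family unfolding eviction_family_iff by blast

lemma min_edges_le_card_Int_subtree:
  assumes "\<And>w D. w \<in> children v \<Longrightarrow> D \<in> F \<Longrightarrow> guard_bound D w" "D \<in> F"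
  shows "min_edges v \<le> card (D \<inter> subtree v)"
proof (cases "v \<in> D")
  case True
  then obtain D' where D': "D' \<in> F" "v \<notin> D'" "guards_move G D D'"
    using family_evict assms(2) by blast
  then have "min_edges v \<le> card (D' \<inter> subtree v)"
    using assms(1) by (intro guard_bound_unoccupied)
  also have "\<dots> \<le> card (D \<inter> subtree v)"
    using D' by (intro card_Int_subtree_guards_move_le) auto
  finally show ?thesis .
qed (use assms in \<open>blast intro: guard_bound_unoccupied\<close>)

text \<open>
  Evicting the guard on the supporting child \<open>h\<close> of a needy child leads to a configuration in
  which the subtree is no longer tight, and only \<open>par v\<close> can have supplied the additional guard.
\<close>

lemma guard_tight_Demanding:
  assumes bound: "\<And>w D. w \<in> children v \<Longrightarrow> D \<in> F \<Longrightarrow> guard_bound D w"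
    and "v \<in> verts G" "D \<in> F" "kind v = Demanding" "guard_tight D v"
  shows "v \<noteq> r \<and> par v \<in> D"
proof (cases "\<exists>w\<in>children v. kind w = Needy")
  case False
  then have "\<forall>w\<in>children v. kind w = Neutral" using kind_DemandingD assms(4) by blast
  then show ?thesis
    using guard_tight_dominator[OF family_dominating] assms by fastforce
next
  case True
  then obtain w where w: "w \<in> children v" "kind w = Needy" by blast
  then obtain h where h: "\<And>x. x \<in> children w \<Longrightarrow> kind x = Supporting \<Longrightarrow> x = h"
    using kind_NeedyD by metis
  have h_occupied: "h \<in> E" if "E \<in> F" "guard_tight E v" for E
  proof -
    have "v \<notin> E" "guard_demand_met E w"
      using guard_tight_unoccupied[of v E] bound that assms(4) w(1) by auto
    then show ?thesis
      using h w(2) par_child[OF w(1)] by (auto simp: guard_demand_met_def)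
  qed
  then obtain D' where D': "D' \<in> F" "h \<notin> D'" "guards_move G D D'"
    using family_evict assms(3,5) by blast
  then have "\<not> guard_tight D' v" using h_occupied by blast
  moreover have "min_edges v \<le> card (D' \<inter> subtree v)"
    using min_edges_le_card_Int_subtree bound D'(1) by blast
  ultimately have "card (D \<inter> subtree v) < card (D' \<inter> subtree v)"
    using assms(5) by (simp add: guard_tight_def)
  then show ?thesis using card_Int_subtree_guards_move_le[OF D'(3), of v] by auto
qed

lemma guard_bound_family:
  assumes "v \<in> verts G" "D \<in> F"
  shows "guard_bound D v"
  using assms
proof (induction v arbitrary: D rule: children_induct)
  case (children v)
  note bound = children.IH
  have "guard_demand_met D v" if "guard_tight D v"
  proof (cases "kind v = Supporting")
    case False
    have "v \<notin> D" using guard_tight_unoccupied(1) bound children.prems False that by blast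
    moreover have "v \<noteq> r \<and> par v \<in> D \<or> (\<exists>h\<in>children v. kind h = Supporting \<and> h \<in> D)"
      using guard_tight_dominator[OF family_dominating] bound children False that by blast
    moreover have "v \<noteq> r \<and> par v \<in> D" if "kind v = Demanding"
      using guard_tight_Demanding bound children.hyps children.prems that \<open>guard_tight D v\<close>
      by blast
    ultimately show ?thesis by (auto simp: guard_demand_met_def split: kind.split)
  qed (simp add: guard_demand_met_def)
  then show ?case
    using min_edges_le_card_Int_subtree[OF bound children.prems] by (simp add: guard_bound_def)
qed

lemma min_edges_root_le_family_size: "min_edges r \<le> k"
proof -
  obtain D where D: "D \<in> F" using family by (auto simp: eviction_family_iff)
  then have "D \<inter> subtree r = D" "card D = k"
    using family dominating_setD(1) by (auto simp: eviction_family_iff subtree_root)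
  then show ?thesis
    using guard_bound_family[OF root_in_verts D] by (simp add: guard_bound_def)
qed

end

lemma min_edges_le_eviction_number: "enat (min_edges r) \<le> eviction_number G"
  unfolding eviction_number_def
  using min_edges_root_le_family_size by (intro Inf_greatest) auto

end

section \<open>Lower bound for star partitionings\<close>

context rooted_tree
begin

text \<open>A set \<open>U\<close> of vertices encodes the set of edges from the members of \<open>U\<close> to their parents.\<close>

definition covered :: "'a set \<Rightarrow> 'a set" where
  "covered U = U \<union> par ` U"

definition doubly_covering :: "'a set \<Rightarrow> bool" where
  "doubly_covering U \<longleftrightarrow> U \<subseteq> verts G - {r} \<and>
     (\<forall>v \<in> verts G - covered U. \<exists>x\<in>covered U. \<exists>y\<in>covered U. x \<noteq> y \<and> v \<rightarrow> x \<and> v \<rightarrow> y)"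

definition edges_below :: "'a set \<Rightarrow> 'a \<Rightarrow> nat" where
  "edges_below U v = (\<Sum>w\<in>children v. card (U \<inter> subtree w))"

lemma card_Int_subtree_edges_below: "card (U \<inter> subtree v) = edges_below U v + of_bool (v \<in> U)"
  by (subst card_Int_subtree) (simp add: edges_below_def)

lemma edges_below_unfold:
  "edges_below U v = (\<Sum>w\<in>children v. edges_below U w + of_bool (w \<in> U))"
  by (subst edges_below_def) (simp add: card_Int_subtree_edges_below)

lemma card_eq_edges_below_root:
  assumes "U \<subseteq> verts G - {r}"
  shows "card U = edges_below U r"
proof -
  have "U \<inter> subtree r = U" using assms subtree_root by auto
  then show ?thesis using assms card_Int_subtree_edges_below[of U r] by auto
qed

definition edge_tight :: "'a set \<Rightarrow> 'a \<Rightarrow> bool" where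
  "edge_tight U v \<longleftrightarrow> edges_below U v = min_edges v"

definition edge_demand_met :: "'a set \<Rightarrow> 'a \<Rightarrow> bool" where
  "edge_demand_met U v = (case kind v of
      Supporting \<Rightarrow> True
    | Neutral \<Rightarrow> v \<notin> par ` U
    | Needy \<Rightarrow> v \<notin> par ` U \<and> v \<noteq> r \<and> par v \<in> covered U
    | Demanding \<Rightarrow> v \<notin> par ` U \<and> v \<in> U)"

definition edge_bound :: "'a set \<Rightarrow> 'a \<Rightarrow> bool" where
  "edge_bound U v \<longleftrightarrow> min_edges v \<le> edges_below U v \<and> (edge_tight U v \<longrightarrow> edge_demand_met U v)"

context
  fixes U
  assumes cover: "doubly_covering U"
begin

lemma cover_subset: "U \<subseteq> verts G - {r}"
  using cover by (simp add: doubly_covering_def)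

lemma uncovered_neighbours:
  assumes "v \<in> verts G" "v \<notin> covered U"
  obtains x y where "x \<in> covered U" "y \<in> covered U" "x \<noteq> y" "v \<rightarrow> x" "v \<rightarrow> y"
  using assms cover unfolding doubly_covering_def by blast

lemma in_par_image_iff: "v \<in> par ` U \<longleftrightarrow> (\<exists>w\<in>children v. w \<in> U)"
  using cover_subset by (auto simp: children_def)

lemma edge_tight_children:
  assumes "\<And>w. w \<in> children v \<Longrightarrow> edge_bound U w" and "kind v \<noteq> Supporting" "edge_tight U v"
    and "w \<in> children v"
  shows "w \<notin> U" "edge_demand_met U w"
proof -
  have bound: "min_edges w \<le> edges_below U w" if "w \<in> children v" for w
    using assms(1)[OF that] by (simp add: edge_bound_def)
  have "edges_below U w + of_bool (w \<in> U) = min_edges w"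
    using assms(2-4) edges_below_unfold[of U v] bound
    by (intro min_edges_eq_if_sum_le[of v]) (auto simp: edge_tight_def intro: le_SucI)
  then have "w \<notin> U \<and> edge_tight U w"
    using bound[OF assms(4)] by (auto simp: edge_tight_def)
  then show "w \<notin> U" "edge_demand_met U w" using assms(1,4) by (auto simp: edge_bound_def)
qed

lemma edge_tight_covered_neighbour:
  assumes "\<And>w. w \<in> children v \<Longrightarrow> edge_bound U w" and "kind v \<noteq> Supporting" "edge_tight U v"
    and "x \<in> covered U" "v \<rightarrow> x"
  shows "v \<noteq> r \<and> par v = x \<or> x \<in> children v \<and> kind x = Supporting"
proof -
  consider (child) "x \<in> children v" | (parent) "v \<in> children x"
    using assms(5) by (auto simp: adj_iff_children)
  then show ?thesis
  proof cases
    case child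
    then have "x \<notin> U" "edge_demand_met U x" using edge_tight_children assms(1-3) by blast+
    then have "kind x = Supporting"
      using assms(4) by (auto simp: covered_def edge_demand_met_def split: kind.splits)
    then show ?thesis using child by blast
  next
    case parent
    then show ?thesis using child_not_root par_child by blast
  qed
qed

lemma edge_tight_not_par:
  assumes "\<And>w. w \<in> children v \<Longrightarrow> edge_bound U w" and "kind v \<noteq> Supporting" "edge_tight U v"
  shows "v \<notin> par ` U"
  using edge_tight_children(1)[OF assms] by (simp add: in_par_image_iff)

lemma edge_tight_Needy:
  assumes "\<And>w. w \<in> children v \<Longrightarrow> edge_bound U w" and "v \<in> verts G" "kind v = Needy" "edge_tight U v"
  shows "v \<noteq> r \<and> par v \<in> covered U"
proof (cases "v \<in> U")
  case True
  then show ?thesis using cover_subset by (auto simp: covered_def)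
next
  case False
  then have "v \<notin> covered U" using edge_tight_not_par assms by (auto simp: covered_def)
  then obtain x y where xy: "x \<in> covered U" "y \<in> covered U" "x \<noteq> y" "v \<rightarrow> x" "v \<rightarrow> y"
    using uncovered_neighbours assms(2) by blast
  have "z \<in> children v \<and> kind z = Supporting" if "\<not> (v \<noteq> r \<and> par v \<in> covered U)"
    "z \<in> covered U" "v \<rightarrow> z" for z
    using edge_tight_covered_neighbour[of v z] assms that by auto
  then show ?thesis using xy kind_NeedyD[OF assms(3)] by metis
qed

lemma edge_tight_Demanding:
  assumes "\<And>w. w \<in> children v \<Longrightarrow> edge_bound U w"
    and "v \<in> verts G" "kind v = Demanding" "edge_tight U v"
  shows "v \<in> U"
proof (cases "\<exists>w\<in>children v. kind w = Needy")
  case True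
  then obtain w where w: "w \<in> children v" "kind w = Needy" by blast
  then have "edge_demand_met U w" using edge_tight_children(2)[of v w] assms by auto
  then have "v \<in> covered U" using w par_child by (auto simp: edge_demand_met_def)
  then show ?thesis using edge_tight_not_par assms by (auto simp: covered_def)
next
  case False
  then have neutral: "\<forall>w\<in>children v. kind w = Neutral" using kind_DemandingD assms(3) by blast
  show ?thesis
  proof (rule ccontr)
    assume "v \<notin> U"
    then have "v \<notin> covered U" using edge_tight_not_par assms by (auto simp: covered_def)
    then obtain x y where "x \<in> covered U" "y \<in> covered U" "x \<noteq> y" "v \<rightarrow> x" "v \<rightarrow> y"
      using uncovered_neighbours assms(2) by blast
    then show False
      using edge_tight_covered_neighbour[of v x] edge_tight_covered_neighbour[of v y] assms neutral
      by auto
  qed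
qed

lemma edge_bound_doubly_covering:
  assumes "v \<in> verts G"
  shows "edge_bound U v"
  using assms
proof (induction v rule: children_induct)
  case (children v)
  note bound = children.IH
  have "min_edges w + of_bool (kind w = Demanding) \<le> edges_below U w + of_bool (w \<in> U)"
    if "w \<in> children v" for w
    using bound[OF that]
    by (cases "edge_tight U w") (auto simp: edge_bound_def edge_demand_met_def edge_tight_def)
  then have "min_edges v \<le> edges_below U v"
    by (subst min_edges.simps, subst edges_below_unfold) (rule sum_mono)
  moreover have "edge_demand_met U v" if "edge_tight U v"
    using edge_tight_not_par edge_tight_Needy edge_tight_Demanding bound children.hyps that
    by (auto simp: edge_demand_met_def split: kind.split)
  ultimately show ?case by (simp add: edge_bound_def)
qed

lemma min_edges_root_le_card_doubly_covering: "min_edges r \<le> card U"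
  using edge_bound_doubly_covering[OF root_in_verts] card_eq_edges_below_root[OF cover_subset]
  by (simp add: edge_bound_def)

end

definition internal_edges :: "'a set set \<Rightarrow> 'a set" where
  "internal_edges P = {w \<in> verts G - {r}. \<exists>A\<in>P. w \<in> A \<and> par w \<in> A}"

lemma card_internal_edges_le:
  assumes "partition_on (verts G) P"
  shows "card (internal_edges P) \<le> partition_weight P"
proof -
  let ?E = "\<lambda>A. {w \<in> A. w \<noteq> r \<and> par w \<in> A}"
  have part: "A \<noteq> {}" "A \<subseteq> verts G" "finite A" if "A \<in> P" for A
    using assms that finite_subset[OF _ finite_verts] by (auto simp: partition_on_def)
  have fin: "finite P" using finite_elements[OF finite_verts assms] .
  have "card (?E A) \<le> card A - 1" if A: "A \<in> P" for A
  proof -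
    obtain x where x: "x \<in> A" "\<And>y. y \<in> A \<Longrightarrow> depth x \<le> depth y"
      using part(1,3)[OF A] by (metis arg_min_if_finite(1) arg_min_least)
    then have "?E A \<subseteq> A - {x}"
      using depth_par[of x] part(2)[OF A] by (auto simp: not_le[symmetric])
    then have "card (?E A) \<le> card (A - {x})"
      using part(3)[OF A] by (intro card_mono) auto
    then show ?thesis using x(1) part(3)[OF A] by simp
  qed
  then have "(\<Sum>A\<in>P. card (?E A)) \<le> partition_weight P"
    unfolding partition_weight_def by (rule sum_mono)
  moreover have "card (internal_edges P) \<le> card (\<Union>A\<in>P. ?E A)"
    using fin part(3) by (intro card_mono) (auto simp: internal_edges_def)
  moreover have "card (\<Union>A\<in>P. ?E A) \<le> (\<Sum>A\<in>P. card (?E A))" by (rule card_UN_le[OF fin])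
  ultimately show ?thesis by linarith
qed

lemma covered_internal_edges:
  assumes "A \<in> P" "star_part G A" "card A \<noteq> 1" "x \<in> A"
  shows "x \<in> covered (internal_edges P)"
proof -
  obtain y where y: "y \<in> A" "x \<rightarrow> y" using assms star_part_neighbour by blast
  then consider (child) "x \<in> children y" | (parent) "y \<in> children x"
    by (auto simp: adj_iff_children)
  then show ?thesis
  proof cases
    case child
    then have "x \<in> internal_edges P"
      using assms(1,4) y(1) child_in_verts[OF child] child_not_root[OF child] par_child[OF child]
      by (auto simp: internal_edges_def)
    then show ?thesis by (simp add: covered_def)
  next
    case parent
    then have "y \<in> internal_edges P" "par y = x"
      using assms(1,4) y(1) child_in_verts[OF parent] child_not_root[OF parent] par_child[OF parent]
      by (auto simp: internal_edges_def)
    then show ?thesis by (auto simp: covered_def)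
  qed
qed

lemma doubly_covering_internal_edges:
  assumes "simple_star_partitioning G P"
  shows "doubly_covering (internal_edges P)"
proof -
  have part: "partition_on (verts G) P" and star: "\<And>A. A \<in> P \<Longrightarrow> star_part G A"
    and single: "\<And>A. A \<in> P \<Longrightarrow> card A = 1 \<Longrightarrow>
      2 \<le> card {B \<in> P. card B \<noteq> 1 \<and> parts_adjacent G A B}"
    using assms by (auto simp: simple_star_partitioning_def)
  let ?C = "covered (internal_edges P)"
  have "\<exists>x\<in>?C. \<exists>y\<in>?C. x \<noteq> y \<and> v \<rightarrow> x \<and> v \<rightarrow> y" if v: "v \<in> verts G" "v \<notin> ?C" for v
  proof -
    obtain A where A: "A \<in> P" "v \<in> A" using part v(1) by (auto simp: partition_on_def)
    then have "card A = 1" using covered_internal_edges star v(2) by blast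
    then have "A = {v}" using A(2) by (auto simp: card_1_singleton_iff)
    let ?S = "{B \<in> P. card B \<noteq> 1 \<and> parts_adjacent G A B}"
    have "\<not> card ?S \<le> Suc 0" using single[OF A(1) \<open>card A = 1\<close>] by linarith
    then obtain B C where BC: "B \<in> ?S" "C \<in> ?S" "B \<noteq> C"
      using finite_elements[OF finite_verts part] by (auto simp: card_le_Suc0_iff_eq)
    then obtain x y where xy: "x \<in> B" "v \<rightarrow> x" "y \<in> C" "v \<rightarrow> y"
      by (auto simp: parts_adjacent_def \<open>A = {v}\<close>)
    have "B \<inter> C = {}" using BC part by (auto simp: partition_on_def disjoint_def)
    then have "x \<noteq> y" using xy by auto
    moreover have "x \<in> ?C" "y \<in> ?C" using BC xy star by (auto intro: covered_internal_edges)
    ultimately show ?thesis using xy by blast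
  qed
  then show ?thesis by (auto simp: doubly_covering_def internal_edges_def)
qed

lemma min_edges_le_min_star_weight: "enat (min_edges r) \<le> min_star_weight G"
proof -
  have "min_edges r \<le> partition_weight P" if "simple_star_partitioning G P" for P
  proof -
    have "min_edges r \<le> card (internal_edges P)"
      using doubly_covering_internal_edges[OF that] by (rule min_edges_root_le_card_doubly_covering)
    also have "\<dots> \<le> partition_weight P"
      using that by (intro card_internal_edges_le) (simp add: simple_star_partitioning_def)
    finally show ?thesis .
  qed
  then show ?thesis unfolding min_star_weight_def by (intro Inf_greatest) auto
qed

end

section \<open>Swap sets from matchings\<close>

context rooted_tree
begin

function colour :: "'a set \<Rightarrow> 'a \<Rightarrow> bool" where
  "colour X v = (if v \<in> verts G - {r} then colour X (par v) \<noteq> (v \<in> X) else True)"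
  by auto
termination by (relation "measure (depth \<circ> snd)") (auto simp: depth_par)

declare colour.simps [simp del]

lemma colour_child: "w \<in> children v \<Longrightarrow> colour X w \<longleftrightarrow> colour X v \<noteq> (w \<in> X)"
  using child_in_verts child_not_root par_child by (subst colour.simps) auto

definition swap_colouring :: "'a set \<Rightarrow> ('a \<Rightarrow> bool) \<Rightarrow> bool" where
  "swap_colouring U c \<longleftrightarrow> (\<forall>w\<in>U. c w \<noteq> c (par w)) \<and>
     (\<forall>v \<in> verts G - covered U. \<forall>b. \<exists>x\<in>covered U. v \<rightarrow> x \<and> c x = b)"

lemma ex_covered_child:
  assumes "doubly_covering U" "v \<in> verts G" "v \<notin> covered U"
  obtains x where "x \<in> children v" "x \<in> covered U"
proof -
  obtain x y where xy: "x \<in> covered U" "y \<in> covered U" "x \<noteq> y" "v \<rightarrow> x" "v \<rightarrow> y"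
    using uncovered_neighbours[OF assms] .
  then have "x \<in> children v \<or> y \<in> children v"
    using par_child by (auto simp: adj_iff_children)
  then show ?thesis using xy that by blast
qed

text \<open>
  Besides the edges of \<open>U\<close>, the colour changes along one edge from every uncovered vertex to a
  covered child, so that the two covered neighbours of that vertex get different colours.
\<close>

lemma ex_swap_colouring:
  assumes "doubly_covering U"
  shows "\<exists>c. swap_colouring U c"
proof -
  define h where "h v = (SOME x. x \<in> children v \<and> x \<in> covered U)" for v
  define X where "X = U \<union> h ` (verts G - covered U)"
  let ?c = "colour X"
  have sub: "U \<subseteq> verts G - {r}" using assms by (simp add: doubly_covering_def)
  have h: "h v \<in> children v" "h v \<in> covered U" if "v \<in> verts G" "v \<notin> covered U" for v
    using ex_covered_child[OF assms that] unfolding h_def by (metis (mono_tags, lifting) someI_ex)+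
  have "\<exists>x\<in>covered U. v \<rightarrow> x \<and> ?c x = b" if v: "v \<in> verts G" "v \<notin> covered U" for v b
  proof -
    obtain z where z: "z \<in> covered U" "v \<rightarrow> z" "z \<noteq> h v"
      using uncovered_neighbours[OF assms v] by metis
    have "v \<notin> X" using h(2) v(2) by (auto simp: X_def covered_def)
    have "?c z = ?c v"
    proof (cases "z \<in> children v")
      case True
      have "z \<notin> U" using v(2) par_child[OF True] by (auto simp: covered_def)
      moreover have "z \<noteq> h u" if "u \<in> verts G" "u \<notin> covered U" for u
        using h(1)[OF that] z(3) par_child True by metis
      ultimately have "z \<notin> X" by (auto simp: X_def)
      then show ?thesis using colour_child[OF True] by simp
    next
      case False
      then show ?thesis
        using z(2) colour_child[of v z] \<open>v \<notin> X\<close> by (auto simp: adj_iff_children)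
    qed
    moreover have "?c (h v) \<noteq> ?c v"
      using colour_child[OF h(1)[OF v]] v by (simp add: X_def)
    ultimately show ?thesis
      using z h[OF v] adj_child by (cases "b = ?c v") auto
  qed
  moreover have "?c w \<noteq> ?c (par w)" if "w \<in> U" for w
  proof -
    have "w \<in> children (par w)" "w \<in> X" using that sub in_children_par by (auto simp: X_def)
    then show ?thesis using colour_child by blast
  qed
  ultimately have "swap_colouring U ?c" by (simp add: swap_colouring_def)
  then show ?thesis by blast
qed

definition coloured_end :: "('a \<Rightarrow> bool) \<Rightarrow> bool \<Rightarrow> 'a \<Rightarrow> 'a" where
  "coloured_end c b w = (if c w = b then w else par w)"

lemma coloured_end_image:
  assumes "swap_colouring U c"
  shows "coloured_end c b ` U = {v \<in> covered U. c v = b}"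
proof
  have c: "c w \<noteq> c (par w)" if "w \<in> U" for w
    using assms that by (simp add: swap_colouring_def)
  have "coloured_end c b w \<in> covered U" "c (coloured_end c b w) = b" if "w \<in> U" for w
    using that c[OF that] by (auto simp: coloured_end_def covered_def)
  then show "coloured_end c b ` U \<subseteq> {v \<in> covered U. c v = b}" by auto
  have "v \<in> coloured_end c b ` U" if "v \<in> U" "c v = b" for v
    using that by (intro image_eqI[of _ _ v]) (auto simp: coloured_end_def)
  moreover have "par w \<in> coloured_end c b ` U" if "w \<in> U" "c (par w) = b" for w
    using that c[OF that(1)] by (intro image_eqI[of _ _ w]) (auto simp: coloured_end_def)
  ultimately show "{v \<in> covered U. c v = b} \<subseteq> coloured_end c b ` U" by (auto simp: covered_def)
qed

lemma coloured_ends_adjacent: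
  assumes "U \<subseteq> verts G - {r}" "w \<in> U"
  shows "coloured_end c b w \<rightarrow> coloured_end c (\<not> b) w"
  using assms adj_par graph_symmetric by (auto simp: coloured_end_def)

lemma dominating_set_coloured_ends:
  assumes "doubly_covering U" and colouring: "swap_colouring U c"
  shows "dominating_set G (coloured_end c b ` U)"
  unfolding dominating_set_def
proof (intro conjI ballI)
  have sub: "U \<subseteq> verts G - {r}" using assms(1) by (simp add: doubly_covering_def)
  then have "covered U \<subseteq> verts G" using par_in_verts by (auto simp: covered_def)
  then show "coloured_end c b ` U \<subseteq> verts G" using coloured_end_image[OF colouring] by auto
  fix v assume v: "v \<in> verts G - coloured_end c b ` U"
  show "\<exists>u\<in>coloured_end c b ` U. u \<rightarrow> v"
  proof (cases "v \<in> covered U")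
    case True
    then have "v \<in> coloured_end c (\<not> b) ` U"
      using v by (auto simp: coloured_end_image[OF colouring])
    then show ?thesis using coloured_ends_adjacent[OF sub] by auto
  next
    case False
    then obtain x where "x \<in> covered U" "v \<rightarrow> x" "c x = b"
      using colouring v unfolding swap_colouring_def by blast
    then show ?thesis using graph_symmetric by (auto simp: coloured_end_image[OF colouring])
  qed
qed

lemma swap_set_of_doubly_covering:
  assumes cover: "doubly_covering U" and matching: "inj_on par U" "par ` U \<inter> U = {}"
  obtains D where "swap_set G D" "card D = card U"
proof -
  obtain c where c: "swap_colouring U c" using ex_swap_colouring[OF cover] by blast
  have sub: "U \<subseteq> verts G - {r}" using cover by (simp add: doubly_covering_def)
  have inj: "inj_on (coloured_end c b) U" for b
    using matching by (auto simp: inj_on_def coloured_end_def split: if_splits)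
  have "coloured_end c True ` U \<inter> coloured_end c False ` U = {}"
    by (auto simp: coloured_end_image[OF c])
  then have "swap_set G (coloured_end c True ` U)"
    using dominating_set_coloured_ends[OF cover c] coloured_ends_adjacent[OF sub, of _ c True]
    by (intro swap_setI[OF inj inj]) simp_all
  then show ?thesis using that card_image[OF inj] by blast
qed

end

section \<open>A cheapest matching in a weak tree\<close>

text \<open>
  Rooting the tree at a neighbour of a leaf makes the root supporting, so that no demand of the
  root remains unmet.
\<close>

locale weak_rooted_tree = rooted_tree +
  assumes root_supports_leaf: "\<exists>l\<in>children r. children l = {}"
    and childless_sibling_unique: "w \<in> children v \<Longrightarrow> w' \<in> children v \<Longrightarrow>
      children w = {} \<Longrightarrow> children w' = {} \<Longrightarrow> w = w'"
begin

text \<open>A childless vertex can only be matched to its parent and is therefore picked first.\<close>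

definition candidates :: "'a \<Rightarrow> 'a set" where
  "candidates v = (case kind v of
      Supporting \<Rightarrow>
        if \<exists>w\<in>children v. children w = {} then {w \<in> children v. children w = {}}
        else {w \<in> children v. kind w = Demanding}
    | Demanding \<Rightarrow>
        if \<exists>w\<in>children v. kind w = Needy then {w \<in> children v. kind w = Needy}
        else children v
    | _ \<Rightarrow> {})"

definition pick :: "'a \<Rightarrow> 'a" where
  "pick v = (SOME w. w \<in> candidates v)"

function matched_up :: "'a \<Rightarrow> bool" where
  "matched_up v =
    (if v \<in> verts G - {r}
     then \<not> matched_up (par v) \<and> v \<in> candidates (par v) \<and> v = pick (par v) else False)"
  by auto
termination by (relation "measure depth") (auto simp: depth_par)

declare matched_up.simps [simp del]

definition cheapest_matching :: "'a set" where
  "cheapest_matching = {v. matched_up v}"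

lemma in_cheapest_matching_iff:
  "v \<in> cheapest_matching \<longleftrightarrow> v \<in> verts G - {r} \<and> par v \<notin> cheapest_matching \<and>
    v \<in> candidates (par v) \<and> v = pick (par v)"
  by (simp add: cheapest_matching_def matched_up.simps[of v])

lemma cheapest_matching_subset: "cheapest_matching \<subseteq> verts G - {r}"
  using in_cheapest_matching_iff by blast

lemma par_notin_cheapest_matching: "v \<in> cheapest_matching \<Longrightarrow> par v \<notin> cheapest_matching"
  and cheapest_matching_candidate: "v \<in> cheapest_matching \<Longrightarrow> v \<in> candidates (par v)"
  and pick_par: "v \<in> cheapest_matching \<Longrightarrow> pick (par v) = v"
  using in_cheapest_matching_iff[of v] by simp_all

lemma candidates_subset: "candidates v \<subseteq> children v"
  by (auto simp: candidates_def split: kind.split)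

lemma pick_in_cheapest_matching:
  assumes "v \<in> verts G" "v \<notin> cheapest_matching" "pick v \<in> candidates v"
  shows "pick v \<in> cheapest_matching"
proof -
  have "pick v \<in> children v" using assms(3) candidates_subset by blast
  then show ?thesis
    using assms child_in_verts child_not_root par_child in_cheapest_matching_iff[of "pick v"]
    by simp
qed

lemma candidates_kind:
  "w \<in> candidates v \<Longrightarrow> kind v = Supporting \<and> kind w = Demanding \<or>
    kind v = Demanding \<and> (kind w = Needy \<or> kind w = Neutral)"
  using kind_childless kind_DemandingD[of v]
  by (auto simp: candidates_def split: if_splits kind.splits)

lemma pick_in_candidates:
  assumes "kind v = Supporting \<or> kind v = Demanding \<and> children v \<noteq> {}"
  shows "pick v \<in> candidates v"
proof -
  have "candidates v \<noteq> {}"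
    using assms kind_Supporting_iff[of v] by (auto simp: candidates_def)
  then show ?thesis unfolding pick_def by (simp add: some_in_eq)
qed

lemma kind_root: "kind r = Supporting"
  using root_supports_leaf kind_childless kind_Supporting_iff by blast

lemma childless_in_cheapest_matching:
  assumes "v \<in> verts G" "v \<noteq> r" "children v = {}"
  shows "v \<in> cheapest_matching"
proof -
  let ?p = "par v"
  have p: "?p \<in> verts G" "v \<in> children ?p" using assms par_in_verts in_children_par by auto
  then have supp: "kind ?p = Supporting" using kind_childless assms(3) kind_Supporting_iff by blast
  then have "?p \<notin> cheapest_matching"
    using candidates_kind[of ?p "par ?p"] cheapest_matching_candidate by auto
  moreover have "candidates ?p = {v}"
    using supp p(2) assms(3) childless_sibling_unique by (auto simp: candidates_def)
  ultimately show ?thesis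
    using pick_in_cheapest_matching[OF p(1)] pick_in_candidates[of ?p] supp by auto
qed

lemma pick_in_candidates_if_Demanding:
  assumes "v \<in> verts G" "v \<notin> cheapest_matching" "kind v = Demanding"
  shows "pick v \<in> candidates v"
  using assms childless_in_cheapest_matching kind_root by (intro pick_in_candidates) fastforce

lemma covered_cheapest_matching:
  assumes "v \<in> verts G" "kind v = Supporting \<or> kind v = Demanding"
  shows "v \<in> covered cheapest_matching"
proof (cases "v \<in> cheapest_matching")
  case False
  then have "pick v \<in> candidates v"
    using assms pick_in_candidates pick_in_candidates_if_Demanding by blast
  then have "pick v \<in> cheapest_matching" "par (pick v) = v"
    using pick_in_cheapest_matching assms(1) False candidates_subset par_child by blast+
  then show ?thesis unfolding covered_def by (metis UnI2 image_eqI)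
qed (simp add: covered_def)

lemma doubly_covering_cheapest_matching: "doubly_covering cheapest_matching"
  unfolding doubly_covering_def
proof (intro conjI ballI)
  let ?C = "covered cheapest_matching"
  show "cheapest_matching \<subseteq> verts G - {r}" by (rule cheapest_matching_subset)
  fix v assume v: "v \<in> verts G - ?C"
  have child: "h \<in> ?C" "v \<rightarrow> h" if "h \<in> children v" "kind h = Supporting" for h
    using that covered_cheapest_matching child_in_verts adj_child by blast+
  have "v \<noteq> r" using v kind_root covered_cheapest_matching by blast
  consider (neutral) "kind v = Neutral" | (needy) "kind v = Needy"
    using v covered_cheapest_matching by (cases "kind v") auto
  then show "\<exists>x\<in>?C. \<exists>y\<in>?C. x \<noteq> y \<and> v \<rightarrow> x \<and> v \<rightarrow> y"
  proof cases
    case neutral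
    then show ?thesis using child kind_NeutralD by metis
  next
    case needy
    have v_child: "v \<in> children (par v)" using v \<open>v \<noteq> r\<close> in_children_par by blast
    then have "par v \<in> ?C"
      using covered_cheapest_matching kind_parent_of_Needy[OF _ needy] parent_in_verts by blast
    moreover obtain h where h: "h \<in> children v" "kind h = Supporting"
      using needy kind_NeedyD by blast
    moreover have "h \<noteq> par v" using depth_child[OF h(1)] depth_child[OF v_child] by auto
    ultimately show ?thesis using child child_adj[OF v_child] by blast
  qed
qed

lemma card_picked_non_Demanding_children:
  assumes "v \<in> verts G"
  shows "card {w \<in> children v. w \<in> cheapest_matching \<and> kind w \<noteq> Demanding}
    = of_bool (kind v = Demanding \<and> v \<notin> cheapest_matching)"
proof (cases "kind v = Demanding \<and> v \<notin> cheapest_matching")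
  case True
  then have "pick v \<in> candidates v" using pick_in_candidates_if_Demanding assms by blast
  then have "pick v \<in> children v" "kind (pick v) \<noteq> Demanding" "pick v \<in> cheapest_matching"
    using True assms pick_in_cheapest_matching candidates_subset candidates_kind by fastforce+
  moreover have "w = pick v" if "w \<in> children v" "w \<in> cheapest_matching" for w
    using pick_par[OF that(2)] par_child[OF that(1)] by simp
  ultimately have "{w \<in> children v. w \<in> cheapest_matching \<and> kind w \<noteq> Demanding} = {pick v}"
    by blast
  then show ?thesis using True by simp
next
  case False
  then have none_picked: "{w \<in> children v. w \<in> cheapest_matching \<and> kind w \<noteq> Demanding} = {}"
    using candidates_kind par_notin_cheapest_matching cheapest_matching_candidate par_child
    by fastforce
  show ?thesis using False unfolding none_picked by auto
qed

lemma edges_below_cheapest_matching: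
  assumes "v \<in> verts G"
  shows "edges_below cheapest_matching v
    = min_edges v + of_bool (kind v = Demanding \<and> v \<notin> cheapest_matching)"
  using assms
proof (induction v rule: children_induct)
  case (children v)
  let ?picked = "\<lambda>w. w \<in> cheapest_matching \<and> kind w \<noteq> Demanding"
  have "edges_below cheapest_matching w + of_bool (w \<in> cheapest_matching)
      = min_edges w + of_bool (kind w = Demanding) + of_bool (?picked w)"
    if "w \<in> children v" for w
    using children.IH[OF that] by auto
  then have "edges_below cheapest_matching v = min_edges v + (\<Sum>w\<in>children v. of_bool (?picked w))"
    by (subst edges_below_unfold, subst min_edges.simps) (simp add: sum.distrib)
  also have "(\<Sum>w\<in>children v. of_bool (?picked w)) = card {w \<in> children v. ?picked w}"
    by (simp add: Int_def)
  also have "\<dots> = of_bool (kind v = Demanding \<and> v \<notin> cheapest_matching)"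
    using card_picked_non_Demanding_children[OF children.hyps] .
  finally show ?case .
qed

lemma card_cheapest_matching: "card cheapest_matching = min_edges r"
  using card_eq_edges_below_root[OF cheapest_matching_subset]
    edges_below_cheapest_matching[OF root_in_verts] kind_root by simp

lemma swap_number_le_min_edges: "swap_number G \<le> enat (min_edges r)"
proof -
  have "inj_on par cheapest_matching" by (metis pick_par inj_onI)
  moreover have "par ` cheapest_matching \<inter> cheapest_matching = {}"
    using par_notin_cheapest_matching by blast
  ultimately obtain D where "swap_set G D" "card D = min_edges r"
    using swap_set_of_doubly_covering[OF doubly_covering_cheapest_matching] card_cheapest_matching
    by metis
  then show ?thesis
    unfolding swap_number_def by (metis (mono_tags, lifting) Inf_lower mem_Collect_eq)
qed

end

section \<open>Rooting an undirected tree\<close>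

context graph
begin

lemma neighbours_eq_if_reachable_without:
  assumes acyclic: "\<not> (\<exists>p. cycle p \<and> 3 \<le> length p)"
    and "v \<rightarrow> a" "v \<rightarrow> b" and avoiding: "a \<rightarrow>\<^sup>*\<^bsub>G \<restriction> (verts G - {v})\<^esub> b"
  shows "a = b"
proof (rule ccontr)
  assume "a \<noteq> b"
  interpret H: wf_digraph "G \<restriction> (verts G - {v})" by (rule wellformed_induce_subgraph)
  obtain p where p: "H.apath a p b" using avoiding H.reachable_apath by blast
  have sub: "subgraph (G \<restriction> (verts G - {v})) G" using induced_induce by blast
  have path: "apath a p b" using subgraph_apath_imp_apath[OF p sub] .
  have "set (H.awalk_verts a p) \<subseteq> verts (G \<restriction> (verts G - {v}))"
    using p by (auto simp: H.apath_def simp del: induce_subgraph_verts)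
  then have v_avoided: "v \<notin> set (awalk_verts a p)" by (auto simp: awalk_verts_induce)
  obtain e where e: "e \<in> arcs G" "tail G e = v" "head G e = a" using assms(2) by auto
  obtain e' where e': "e' \<in> arcs G" "tail G e' = b" "head G e' = v"
    using graph_symmetric[OF assms(3)] by auto
  have "p \<noteq> []" using path \<open>a \<noteq> b\<close> by (auto simp: apath_Nil_iff)
  have path_walk: "awalk a p b" "distinct (awalk_verts a p)" using path by (auto simp: apath_def)
  have "awalk b [e'] v" using e' by (auto simp: awalk_simps)
  then have walk: "awalk a (p @ [e']) v" using path_walk awalk_appendI by blast
  have "awalk_verts a (p @ [e']) = awalk_verts a p @ [v]"
    using awalk_verts_append[OF walk] e' by simp
  then have "cycle (e # p @ [e'])"
    unfolding cycle_def using walk e path_walk v_avoided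
    by (intro exI[of _ v]) (auto simp: awalk_Cons_iff)
  moreover have "3 \<le> length (e # p @ [e'])" using \<open>p \<noteq> []\<close> by (cases p) auto
  ultimately show False using acyclic by blast
qed

definition dist_from :: "'a \<Rightarrow> 'a \<Rightarrow> nat" where
  "dist_from r v = (LEAST n. \<exists>p. awalk r p v \<and> length p = n)"

lemma dist_from_le: "awalk r p v \<Longrightarrow> dist_from r v \<le> length p"
  unfolding dist_from_def by (intro Least_le) auto

lemma ex_closer_neighbour:
  assumes "r \<rightarrow>\<^sup>* v" "v \<noteq> r"
  obtains u where "v \<rightarrow> u" "dist_from r u < dist_from r v"
proof -
  have "\<exists>n p. awalk r p v \<and> length p = n" using assms(1) by (auto simp: reachable_awalk)
  then have "\<exists>p. awalk r p v \<and> length p = dist_from r v"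
    unfolding dist_from_def by (rule LeastI_ex)
  then obtain p where p: "awalk r p v" "length p = dist_from r v" by blast
  have "p \<noteq> []" using p(1) assms(2) by (auto simp: awalk_Nil_iff)
  then obtain q e where p_snoc: "p = q @ [e]" by (metis append_butlast_last_id)
  then have q: "awalk r q (tail G e)" and e: "tail G e \<rightarrow> v"
    using p(1) in_arcs_imp_in_arcs_ends[of e] by (auto simp: awalk_simps)
  show ?thesis
    using that[OF graph_symmetric[OF e]] dist_from_le[OF q] p(2) p_snoc by simp
qed

lemma reachable_without_farther_vertex:
  assumes "strongly_connected G" "r \<in> verts G" "u \<in> verts G" "u \<noteq> v"
    and "dist_from r u \<le> dist_from r v"
  shows "r \<rightarrow>\<^sup>*\<^bsub>G \<restriction> (verts G - {v})\<^esub> u"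
  using assms(3-)
proof (induction "dist_from r u" arbitrary: u rule: less_induct)
  case less
  interpret H: wf_digraph "G \<restriction> (verts G - {v})" by (rule wellformed_induce_subgraph)
  show ?case
  proof (cases "u = r")
    case True
    then show ?thesis using less.prems by simp
  next
    case False
    have "r \<rightarrow>\<^sup>* u" using assms(1,2) less.prems(1) by blast
    then obtain w where w: "u \<rightarrow> w" "dist_from r w < dist_from r u"
      using ex_closer_neighbour False by blast
    have "w \<noteq> v" using w(2) less.prems(3) by auto
    then have "r \<rightarrow>\<^sup>*\<^bsub>G \<restriction> (verts G - {v})\<^esub> w"
      using less.hyps[OF w(2) adj_in_verts(2)[OF w(1)]] w(2) less.prems(3) by simp
    moreover have "w \<rightarrow>\<^bsub>G \<restriction> (verts G - {v})\<^esub> u"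
      using graph_symmetric[OF w(1)] adj_in_verts[OF w(1)] \<open>w \<noteq> v\<close> less.prems(2)
      by (simp add: arcs_ends_induce)
    ultimately show ?thesis by (rule H.reachable_adj_trans)
  qed
qed

lemma strongly_connected_undirected_tree: "undirected_tree G \<Longrightarrow> strongly_connected G"
  using symmetric_connected_imp_strongly_connected[OF sym_arcs] by (simp add: undirected_tree_def)

lemma closer_neighbour_unique:
  assumes "undirected_tree G" "r \<in> verts G" "v \<rightarrow> a" "v \<rightarrow> b"
    and "dist_from r a \<le> dist_from r v" "dist_from r b \<le> dist_from r v"
  shows "a = b"
proof -
  let ?H = "G \<restriction> (verts G - {v})"
  interpret H: wf_digraph ?H by (rule wellformed_induce_subgraph)
  have "r \<rightarrow>\<^sup>*\<^bsub>?H\<^esub> u" if "v \<rightarrow> u" "dist_from r u \<le> dist_from r v" for u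
    using reachable_without_farther_vertex[OF strongly_connected_undirected_tree[OF assms(1)] assms(2)
        adj_in_verts(2)[OF that(1)] _ that(2)] that(1) adj_not_same by blast
  then have "r \<rightarrow>\<^sup>*\<^bsub>?H\<^esub> a" "r \<rightarrow>\<^sup>*\<^bsub>?H\<^esub> b" using assms(3-) by blast+
  moreover have "symmetric ?H" by (rule induced_graph_imp_symmetric[OF sym_arcs]) auto
  ultimately have "a \<rightarrow>\<^sup>*\<^bsub>?H\<^esub> b" using symmetric_reachable H.reachable_trans by metis
  then show ?thesis
    using neighbours_eq_if_reachable_without assms(1,3,4) by (simp add: undirected_tree_def)
qed

lemma not_root_if_adj_not_farther:
  assumes "r \<in> verts G" "r \<rightarrow>\<^sup>* y" "x \<rightarrow> y" "dist_from r y \<le> dist_from r x"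
  shows "x \<noteq> r"
proof
  assume "x = r"
  then have "y \<noteq> r" using assms(3) adj_not_same by blast
  then obtain u where "dist_from r u < dist_from r y" using ex_closer_neighbour assms(2) by blast
  moreover have "dist_from r r = 0"
    using dist_from_le[of r "[]" r] assms(1) by (simp add: awalk_Nil_iff)
  ultimately show False using assms(4) \<open>x = r\<close> by simp
qed

lemma undirected_tree_rooted:
  assumes "undirected_tree G" "r \<in> verts G"
  obtains par depth where "rooted_tree G r par depth"
proof -
  define par where "par v = (SOME u. v \<rightarrow> u \<and> dist_from r u < dist_from r v)" for v
  have reach: "r \<rightarrow>\<^sup>* v" if "v \<in> verts G" for v
    using strongly_connected_undirected_tree assms that by blast
  have par: "v \<rightarrow> par v" "dist_from r (par v) < dist_from r v" if "v \<in> verts G" "v \<noteq> r" for v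
  proof -
    have "\<exists>u. v \<rightarrow> u \<and> dist_from r u < dist_from r v"
      using ex_closer_neighbour reach that by blast
    then show "v \<rightarrow> par v" "dist_from r (par v) < dist_from r v"
      unfolding par_def by (rule someI2_ex, simp)+
  qed
  have par_eq: "x \<noteq> r \<and> par x = y" if "x \<rightarrow> y" "dist_from r y \<le> dist_from r x" for x y
  proof -
    have x: "x \<in> verts G" "x \<noteq> r"
      using not_root_if_adj_not_farther assms(2) reach that adj_in_verts by blast+
    then show ?thesis
      using closer_neighbour_unique[OF assms _ that(1) _ that(2)] par[OF x] by simp
  qed
  have "rooted_tree G r par (dist_from r)"
  proof
    show "x \<noteq> r \<and> par x = y \<or> y \<noteq> r \<and> par y = x" if "x \<rightarrow> y" for x y
      using par_eq[OF that] par_eq[OF graph_symmetric[OF that]] by linarith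
  qed (use assms(2) par in auto)
  then show ?thesis using that by blast
qed

lemma ex_leaf:
  assumes "undirected_tree G" "2 \<le> card (verts G)"
  obtains l where "leaf G l"
proof -
  have "\<not> card (verts G) \<le> Suc 0" using assms(2) by simp
  then obtain r v where two_verts: "r \<in> verts G" "v \<in> verts G" "v \<noteq> r"
    by (auto simp: card_le_Suc0_iff_eq)
  obtain par depth where "rooted_tree G r par depth"
    using undirected_tree_rooted[OF assms(1) two_verts(1)] .
  then interpret rooted_tree G r par depth .
  show ?thesis using ex_childless_vertex[OF two_verts(2,3)] leaf_iff_childless that by metis
qed

lemma weak_leaf_unique:
  assumes "weak_graph G" "leaf G l" "leaf G l'" "v \<rightarrow> l" "v \<rightarrow> l'"
  shows "l = l'"
proof -
  have "finite (leaf_neighbours G v)"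
    by (rule finite_subset[OF _ finite_verts]) (auto simp: leaf_neighbours_def leaf_def)
  moreover have "card (leaf_neighbours G v) \<le> Suc 0"
    using assms(1) adj_in_verts(1)[OF assms(4)] by (fastforce simp: weak_graph_def not_le)
  ultimately show ?thesis using assms by (simp add: card_le_Suc0_iff_eq leaf_neighbours_def)
qed

lemma weak_tree_rooted:
  assumes "undirected_tree G" "weak_graph G" "2 \<le> card (verts G)"
  obtains r par depth where "weak_rooted_tree G r par depth"
proof -
  obtain l where l: "leaf G l" using ex_leaf assms by blast
  then have "card {w. l \<rightarrow> w} = 1" by (simp add: leaf_def out_degree_eq_card)
  then obtain r where "l \<rightarrow> r" by (metis card_1_singletonE mem_Collect_eq singletonI)
  then obtain par depth where "rooted_tree G r par depth"
    using undirected_tree_rooted assms(1) adj_in_verts(2) by blast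
  then interpret rooted_tree G r par depth .
  have "l \<in> children r" using \<open>l \<rightarrow> r\<close> child_not_root by (auto simp: adj_iff_children)
  moreover from this have "children l = {}"
    using l leaf_iff_childless child_in_verts child_not_root by blast
  moreover have "w = w'"
    if "w \<in> children v" "w' \<in> children v" "children w = {}" "children w' = {}" for v w w'
    using that leaf_iff_childless child_in_verts child_not_root adj_child
      weak_leaf_unique[OF assms(2)] by metis
  ultimately have "weak_rooted_tree G r par depth" by unfold_locales blast+
  then show ?thesis using that by blast
qed

end

theorem corollary12:
  fixes T :: "('a, 'b) pre_digraph"
  assumes "graph T"
    and "undirected_tree T"
    and "2 \<le> card (verts T)"
    and "weak_graph T"
  shows "swap_number T = min_star_weight T \<and> min_star_weight T = eviction_number T"
proof -
  interpret graph T by fact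
  obtain r par depth where "weak_rooted_tree T r par depth"
    using weak_tree_rooted assms(2-4) by blast
  then interpret weak_rooted_tree T r par depth .
  let ?m = "enat (min_edges r)"
  have "swap_number T \<le> ?m" by (rule swap_number_le_min_edges)
  moreover have "min_star_weight T \<le> swap_number T"
    using triangle_free_rooted_tree by (rule min_star_weight_le_swap_number)
  moreover have "eviction_number T \<le> swap_number T" by (rule eviction_number_le_swap_number)
  moreover have "?m \<le> min_star_weight T" by (rule min_edges_le_min_star_weight)
  moreover have "?m \<le> eviction_number T" by (rule min_edges_le_eviction_number)
  ultimately show ?thesis by auto
qed

end
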